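(* Let $q$ be a prime power, $n\ge1$, $\sigma$ a generator of $\mathrm{Gal}(\mathbb{F}_{q^n}/\mathbb{F}_q)$, and $L=a_0x+\dots+a_dx^{\sigma^d}\in\mathbb{F}_{q^n}[x]$ a $\sigma$-linearized polynomial of $\sigma$-degree $d\ge1$. Then all coefficients of the characteristic polynomial of $A_L$ lie in $\mathbb{F}_q$.
   Context: $C_L$ is the $d\times d$ matrix with $1$'s on the subdiagonal, last column $(-a_0/a_d,\dots,-a_{d-1}/a_d)^T$, zeros elsewhere; $C_L^{\sigma^i}$ denotes entrywise application of $\sigma^i$; $A_L:=C_LC_L^{\sigma}\cdots C_L^{\sigma^{n-1}}$. *)

theory Defs
  imports
    "Jordan_Normal_Form.Char_Poly"
    "Jordan_Normal_Form.VS_Connect"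
    "HOL-Algebra.Generated_Groups"
    "HOL-Algebra.QuotRing"
    "HOL-Algebra.Subrings"
    "HOL-Number_Theory.Prime_Powers"
begin

definition Gal :: "'a::field set \<Rightarrow> ('a \<Rightarrow> 'a) monoid" where
  "Gal K = \<lparr>carrier = {\<phi> \<in> ring_iso class_ring class_ring. \<forall>x\<in>K. \<phi> x = x},
             mult = (\<circ>), one = id\<rparr>"

lemma group_Gal: "group (Gal (K :: 'a::field set))"
proof (rule groupI)
  let ?R = "class_ring :: 'a ring"
  have iso: "\<phi> \<in> ring_iso ?R ?R \<longleftrightarrow> bij \<phi> \<and> (\<forall>x y. \<phi> (x + y) = \<phi> x + \<phi> y)
      \<and> (\<forall>x y. \<phi> (x * y) = \<phi> x * \<phi> y) \<and> \<phi> 1 = 1" for \<phi> :: "'a \<Rightarrow> 'a"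
    by (auto simp: ring_iso_def ring_hom_def)
  show "\<one>\<^bsub>Gal K\<^esub> \<in> carrier (Gal K)"
    unfolding Gal_def by (simp add: iso)
  show "x \<otimes>\<^bsub>Gal K\<^esub> y \<in> carrier (Gal K)"
    if "x \<in> carrier (Gal K)" "y \<in> carrier (Gal K)" for x y
    using that unfolding Gal_def by (simp add: iso bij_comp)
  show "\<exists>y\<in>carrier (Gal K). y \<otimes>\<^bsub>Gal K\<^esub> x = \<one>\<^bsub>Gal K\<^esub>" if x: "x \<in> carrier (Gal K)" for x
  proof -
    have b: "bij x" and ad: "\<And>u v. x (u + v) = x u + x v"
      and mu: "\<And>u v. x (u * v) = x u * x v" and o: "x 1 = 1" and f: "\<And>u. u \<in> K \<Longrightarrow> x u = u"
      using x unfolding Gal_def by (simp_all add: iso)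
    define y where "y = inv_into UNIV x"
    have xy: "x (y u) = u" and yx: "y (x u) = u" for u
      using b unfolding y_def by (simp_all add: bij_is_surj surj_f_inv_f bij_is_inj inv_f_f)
    have "bij y" using b unfolding y_def by (rule bij_imp_bij_inv)
    moreover have "y (u + v) = y u + y v" for u v by (metis ad xy yx)
    moreover have "y (u * v) = y u * y v" for u v by (metis mu xy yx)
    moreover have "y 1 = 1" by (metis o yx)
    moreover have "y u = u" if "u \<in> K" for u by (metis f[OF that] yx)
    ultimately have "y \<in> carrier (Gal K)" unfolding Gal_def by (simp add: iso)
    moreover have "y \<circ> x = id" using yx by auto
    ultimately show ?thesis unfolding Gal_def by auto
  qed
qed (auto simp: Gal_def comp_assoc)

text \<open>
  In the polynomial ring over the extension of degree \<open>n\<close> of the field with \<open>q\<close> elements, the symbol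
  \<open>x\<^sup>\<sigma>\<close> denotes the monomial \<open>x ^ (q ^ s)\<close>, where \<open>\<sigma>\<close> is the Frobenius power \<open>t \<mapsto> t ^ (q ^ s)\<close>.
  Every element of the Galois group has this form, and \<open>s\<close> is only determined modulo \<open>n\<close>. The least
  positive \<open>s\<close> is taken (so \<open>s = 1\<close> if \<open>n = 1\<close>); positivity makes the monomials \<open>x^{\<sigma>^i}\<close>,
  \<open>i \<ge> 0\<close>, pairwise distinct, so that coefficients and \<open>\<sigma>\<close>-degree are well defined.
\<close>

definition sigma_exp :: "nat \<Rightarrow> ('a::field \<Rightarrow> 'a) \<Rightarrow> nat" where
  "sigma_exp q \<sigma> = (LEAST s. 0 < s \<and> (\<forall>t. \<sigma> t = t ^ (q ^ s)))"

definition sigma_monom :: "nat \<Rightarrow> ('a::field \<Rightarrow> 'a) \<Rightarrow> nat \<Rightarrow> 'a poly" where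
  "sigma_monom q \<sigma> i = Polynomial.monom 1 (q ^ (sigma_exp q \<sigma> * i))"

definition sigma_coeff :: "nat \<Rightarrow> ('a::field \<Rightarrow> 'a) \<Rightarrow> 'a poly \<Rightarrow> nat \<Rightarrow> 'a" where
  "sigma_coeff q \<sigma> L i = Polynomial.coeff L (q ^ (sigma_exp q \<sigma> * i))"

definition sigma_linearized :: "nat \<Rightarrow> ('a::field \<Rightarrow> 'a) \<Rightarrow> nat \<Rightarrow> 'a poly \<Rightarrow> bool" where
  "sigma_linearized q \<sigma> d L \<longleftrightarrow>
     (\<exists>a. a d \<noteq> 0 \<and> L = (\<Sum>i\<le>d. Polynomial.smult (a i) (sigma_monom q \<sigma> i)))"

definition C_mat :: "nat \<Rightarrow> ('a::field \<Rightarrow> 'a) \<Rightarrow> nat \<Rightarrow> 'a poly \<Rightarrow> 'a mat" where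
  "C_mat q \<sigma> d L = mat d d (\<lambda>(i, j).
     if j = d - 1 then - sigma_coeff q \<sigma> L i / sigma_coeff q \<sigma> L d
     else if i = j + 1 then 1 else 0)"

definition A_mat :: "nat \<Rightarrow> nat \<Rightarrow> ('a::field \<Rightarrow> 'a) \<Rightarrow> nat \<Rightarrow> 'a poly \<Rightarrow> 'a mat" where
  "A_mat q n \<sigma> d L =
     foldr (\<lambda>i M. map_mat (\<sigma> ^^ i) (C_mat q \<sigma> d L) * M) [0..<n] (1\<^sub>m d)"

end

theory Submission
  imports Defs "HOL-Number_Theory.Residues"
begin

text \<open>
  Write \<open>A = C * B\<close> with \<open>B\<close> the product of the conjugates \<open>C\<^sup>\<sigma>, \<dots>\<close>. Since \<open>\<sigma>\<^sup>n = id\<close>, applying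
  \<open>\<sigma>\<close> to the entries of \<open>A\<close> gives \<open>B * C\<close>, which has the same characteristic polynomial as
  \<open>C * B\<close> (also when \<open>C\<close> is singular). So \<open>\<sigma>\<close> fixes the coefficients of the characteristic polynomial.
  As \<open>\<sigma>\<close> generates the Galois group, they are then fixed by the Frobenius map \<open>x \<mapsto> x\<^sup>q\<close>, and the
  roots of \<open>X\<^sup>q - X\<close> are exactly the elements of \<open>K\<close>.
\<close>

section \<open>Characteristic polynomials of products\<close>

text \<open>The block matrix \<open>?M\<close> has determinant \<open>det (X - a * b)\<close>.
  Multiplying it on the left by \<open>?N\<close>, of determinant \<open>det X\<close>, clears the
  lower left block, which gives \<open>det X * det (X - b * a)\<close>. Here \<open>det X\<close> is
  a power of the variable, so it cancels over a domain.\<close>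

lemma char_poly_mult_commute:
  fixes A B :: "'a::idom mat"
  assumes A: "A \<in> carrier_mat m m" and B: "B \<in> carrier_mat m m"
  shows "char_poly (A * B) = char_poly (B * A)"
proof -
  interpret cp: comm_ring_hom "\<lambda>a::'a. [:a:]"
    by unfold_locales (auto simp: one_pCons)
  define a where "a = map_mat (\<lambda>c. [:c:]) A"
  define b where "b = map_mat (\<lambda>c. [:c:]) B"
  define X where "X = ([:0, 1:] :: 'a poly) \<cdot>\<^sub>m 1\<^sub>m m"
  have a: "a \<in> carrier_mat m m" and b: "b \<in> carrier_mat m m" and X: "X \<in> carrier_mat m m"
    using A B by (auto simp: a_def b_def X_def)
  have cp_eq: "char_poly M = det (X - map_mat (\<lambda>c. [:c:]) M)" if "M \<in> carrier_mat m m" for M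
    unfolding char_poly_defs X_def using that by (intro arg_cong[where f = det] eq_matI) auto
  have ab: "char_poly (A * B) = det (X - a * b)" and ba: "char_poly (B * A) = det (X - b * a)"
    using A B by (simp_all add: cp_eq a_def b_def cp.mat_hom_mult)
  have Xb: "X * b = b * X"
    using b by (simp add: X_def mult_smult_distrib[OF b one_carrier_mat]
        mult_smult_assoc_mat[OF one_carrier_mat b])
  let ?M = "four_block_mat X a b (1\<^sub>m m)"
  let ?N = "four_block_mat (1\<^sub>m m) (0\<^sub>m m m) (- b) X"
  \<comment> \<open>The lower left block vanishes because the scalar matrix \<open>X\<close>
    commutes with \<open>b\<close>.\<close>
  have "?N * ?M = four_block_mat X a (0\<^sub>m m m) (X - b * a)"
  proof (subst mult_four_block_mat[OF one_carrier_mat zero_carrier_mat _ X X a b one_carrier_mat])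
    show "- b \<in> carrier_mat m m" using b by simp
    have "- b * X + X * b = 0\<^sub>m m m"
      using b X by (simp add: Xb uminus_l_inv_mat)
    moreover have "- b * a + X * 1\<^sub>m m = X - b * a"
      using a b X by (intro eq_matI) (auto simp: uminus_mult_left_mat)
    ultimately show "four_block_mat (1\<^sub>m m * X + 0\<^sub>m m m * b) (1\<^sub>m m * a + 0\<^sub>m m m * 1\<^sub>m m)
        (- b * X + X * b) (- b * a + X * 1\<^sub>m m) = four_block_mat X a (0\<^sub>m m m) (X - b * a)"
      using a b X by simp
  qed
  moreover have "det (?N * ?M) = det ?N * det ?M"
    by (rule det_mult[where n = "m + m"]) (use a b X in auto)
  moreover have "det ?N = det X"
    using b X by (subst det_four_block_mat_upper_right_zero[OF one_carrier_mat]) auto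
  moreover have "det (four_block_mat X a (0\<^sub>m m m) (X - b * a)) = det X * det (X - b * a)"
    using a b X by (intro det_four_block_mat_lower_left_zero[OF X]) auto
  moreover have "det ?M = det (X - a * b)"
    using a b X by (subst det_four_block_mat[OF X a b]) auto
  moreover have "det X \<noteq> 0"
    by (simp add: X_def)
  ultimately show ?thesis
    by (simp add: ab ba)
qed

section \<open>Products of conjugates of a matrix\<close>

text \<open>Serves to split off the last factor of a product taken over
  \<open>is @ [k]\<close>.\<close>

lemma foldr_mat_mult:
  assumes "\<And>i. i \<in> set is \<Longrightarrow> F i \<in> carrier_mat m m" and "D \<in> carrier_mat m m"
  shows "foldr (\<lambda>i M. F i * M) is (1\<^sub>m m) \<in> carrier_mat m m"
    and "foldr (\<lambda>i M. F i * M) is D = foldr (\<lambda>i M. F i * M) is (1\<^sub>m m) * (D :: 'a::semiring_1 mat)"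
proof -
  have "foldr (\<lambda>i M. F i * M) is (1\<^sub>m m) \<in> carrier_mat m m
    \<and> foldr (\<lambda>i M. F i * M) is D = foldr (\<lambda>i M. F i * M) is (1\<^sub>m m) * D"
    using assms(1)
  proof (induction "is")
    case (Cons i "is")
    then have F: "F i \<in> carrier_mat m m" by simp
    from Cons have IH: "foldr (\<lambda>i M. F i * M) is (1\<^sub>m m) \<in> carrier_mat m m"
      "foldr (\<lambda>i M. F i * M) is D = foldr (\<lambda>i M. F i * M) is (1\<^sub>m m) * D" by auto
    show ?case
      using F IH(1) assms(2) by (simp add: IH(2) assoc_mult_mat[OF F IH(1) assms(2)])
  qed (use assms(2) in simp)
  then show "foldr (\<lambda>i M. F i * M) is (1\<^sub>m m) \<in> carrier_mat m m"
    and "foldr (\<lambda>i M. F i * M) is D = foldr (\<lambda>i M. F i * M) is (1\<^sub>m m) * D" by auto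
qed

lemma char_poly_twisted_product:
  fixes \<sigma> :: "'a::idom \<Rightarrow> 'a"
  assumes hom: "comm_ring_hom \<sigma>" and C: "C \<in> carrier_mat m m"
    and n: "n \<ge> 1" and \<sigma>n: "\<sigma> ^^ n = id"
  defines "A \<equiv> foldr (\<lambda>i M. map_mat (\<sigma> ^^ i) C * M) [0..<n] (1\<^sub>m m)"
  shows "map_poly \<sigma> (char_poly A) = char_poly A"
proof -
  interpret comm_ring_hom \<sigma> by fact
  define F where "F i = map_mat (\<sigma> ^^ i) C" for i
  define P where "P is = foldr (\<lambda>i M. F i * M) is (1\<^sub>m m)" for "is"
  have F: "F i \<in> carrier_mat m m" for i
    using C by (simp add: F_def)
  have P: "P is \<in> carrier_mat m m" for "is"
    unfolding P_def using F by (rule foldr_mat_mult(1)) (rule one_carrier_mat)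
  \<comment> \<open>Applying \<sigma> entrywise is multiplicative and raises the exponent in every
    factor by one.\<close>
  have shift: "map_mat \<sigma> (P is) = P (map Suc is)" for "is"
  proof (induction "is")
    case Nil
    then show ?case by (simp add: P_def mat_hom_one)
  next
    case (Cons i "is")
    have "map_mat \<sigma> (F i) = F (Suc i)"
      by (rule eq_matI) (simp_all add: F_def)
    with Cons mat_hom_mult[OF F P, of i "is"] show ?case
      by (simp add: P_def)
  qed
  have C0: "F 0 = C" and Cn: "F n = C"
    by (rule eq_matI; simp add: F_def \<sigma>n)+
  have "[0..<n] = 0 # [1..<n]"
    using n by (simp add: upt_conv_Cons)
  then have A: "A = C * P [1..<n]"
    unfolding A_def F_def[symmetric] by (simp add: P_def C0)
  have "map_mat \<sigma> A = P [Suc 0..<Suc n]"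
    unfolding A_def F_def[symmetric] P_def[symmetric] by (simp only: shift map_Suc_upt)
  \<comment> \<open>The shift drops index 0 and adds index \<open>n\<close>, whose factor is
    \<open>C\<close> again since \<open>\<sigma> ^^ n = id\<close>.\<close>
  also have "[Suc 0..<Suc n] = [1..<n] @ [n]"
    using n by simp
  also have "P ([1..<n] @ [n]) = P [1..<n] * C"
    using foldr_mat_mult(2)[of "[1..<n]" F m C] F C by (simp add: P_def Cn)
  finally have "char_poly (map_mat \<sigma> A) = char_poly A"
    unfolding A by (simp add: char_poly_mult_commute[OF C P])
  moreover have "A \<in> carrier_mat m m"
    using C P A by simp
  ultimately show ?thesis
    by (simp add: char_poly_hom)
qed

section \<open>Galois groups of finite fields\<close>

text \<open>Multiplication by a nonzero \<open>x\<close> permutes the nonzero elements of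
  \<open>K\<close>; comparing their products before and after gives
  \<open>x ^ (card K - 1) = 1\<close>. The statement covers both the base field and the whole
  extension.\<close>

lemma power_card_eq_self:
  fixes x :: "'a::field"
  assumes "finite K" and mult: "\<And>x y. x \<in> K \<Longrightarrow> y \<in> K \<Longrightarrow> x * y \<in> K" and "0 \<in> K" and "x \<in> K"
  shows "x ^ card K = x"
proof (cases "x = 0")
  case True
  with assms show ?thesis
    by (auto simp: power_0_left)
next
  case False
  have "inj_on ((*) x) (K - {0})"
    using False by (auto simp: inj_on_def)
  moreover have "(*) x ` (K - {0}) \<subseteq> K - {0}"
    using False assms by auto
  ultimately have "bij_betw ((*) x) (K - {0}) (K - {0})"
    using assms(1) by (simp add: bij_betw_def endo_inj_surj)
  then have "(\<Prod>y\<in>K - {0}. x * y) = (\<Prod>y\<in>K - {0}. y)"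
    by (rule prod.reindex_bij_betw[where g = "\<lambda>y. y"])
  then have "x ^ card (K - {0}) * (\<Prod>y\<in>K - {0}. y) = (\<Prod>y\<in>K - {0}. y)"
    by (simp only: prod.distrib prod_constant)
  moreover have "(\<Prod>y\<in>K - {0}. y) \<noteq> 0"
    using assms(1) by simp
  ultimately have "x ^ card (K - {0}) = 1"
    by (metis mult_cancel_right1)
  then have "x ^ Suc (card (K - {0})) = x"
    by simp
  also have "Suc (card (K - {0})) = card K"
    using card.remove[OF assms(1,3)] by (rule sym)
  finally show ?thesis .
qed

text \<open>Connects the carrier-based homomorphisms of \<open>Gal\<close> with the locale
  \<open>comm_ring_hom\<close>. The condition \<open>\<phi> 0 = 0\<close>, part of the locale only,
  follows from additivity.\<close>

lemma Gal_iff: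
  "\<phi> \<in> carrier (Gal K) \<longleftrightarrow> comm_ring_hom \<phi> \<and> bij \<phi> \<and> (\<forall>x\<in>K. \<phi> x = x)"
proof
  assume \<phi>: "\<phi> \<in> carrier (Gal K)"
  then have add: "\<phi> (x + y) = \<phi> x + \<phi> y" for x y
    by (simp add: Gal_def ring_iso_def ring_hom_def)
  have "\<phi> 0 = \<phi> 0 + \<phi> 0"
    using add[of 0 0] by (simp only: add_0_right)
  then have "\<phi> 0 = 0"
    by (rule iffD1[OF add_cancel_right_right])
  with \<phi> show "comm_ring_hom \<phi> \<and> bij \<phi> \<and> (\<forall>x\<in>K. \<phi> x = x)"
    by (auto simp: Gal_def ring_iso_def ring_hom_def intro!: comm_ring_hom.intro ring_hom.intro
        semiring_hom.intro) (unfold_locales; simp)+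
next
  assume *: "comm_ring_hom \<phi> \<and> bij \<phi> \<and> (\<forall>x\<in>K. \<phi> x = x)"
  then interpret comm_ring_hom \<phi> by simp
  from * show "\<phi> \<in> carrier (Gal K)"
    by (simp add: Gal_def ring_iso_def ring_hom_def hom_distribs)
qed

lemma generate_Gal_fixes:
  assumes \<sigma>: "\<sigma> \<in> carrier (Gal K)" and x: "\<sigma> x = x" and "\<phi> \<in> generate (Gal K) {\<sigma>}"
  shows "\<phi> x = x"
  using assms(3)
proof (induction rule: generate.induct)
  case (inv h)
  have "inv\<^bsub>Gal K\<^esub> \<sigma> \<circ> \<sigma> = id"
    using group.l_inv[OF group_Gal \<sigma>] by (simp add: Gal_def)
  then have "(inv\<^bsub>Gal K\<^esub> \<sigma>) (\<sigma> x) = x"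
    by (metis comp_apply id_apply)
  with inv x show ?case by simp
qed (use x in \<open>auto simp: Gal_def\<close>)

section \<open>The Frobenius map of a finite extension of finite fields\<close>

locale finite_field_extension =
  fixes K :: "'a::{finite,field} set" and q n :: nat
  assumes primepow_q: "primepow q" and subfield_K: "subfield K class_ring"
    and card_K: "card K = q" and card_UNIV: "card (UNIV :: 'a set) = q ^ n"
begin

lemma q_gt_1: "q > 1"
  using primepow_gt_Suc_0[OF primepow_q] by simp

lemma power_q_eq_iff: "x ^ q = x \<longleftrightarrow> x \<in> K"
proof -
  have sr: "subring K class_ring"
    using subfield_K by (rule subfieldE(1))
  have "0 \<in> K" and "\<And>x y. x \<in> K \<Longrightarrow> y \<in> K \<Longrightarrow> x * y \<in> K"
    using subringE(2,6)[OF sr] by auto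
  then have sub: "K \<subseteq> {x. x ^ q = x}"
    using power_card_eq_self[of K] card_K by auto
  \<comment> \<open>The polynomial \<open>X^q - X\<close> has at most \<open>q\<close> roots, and
    the \<open>q\<close> elements of \<open>K\<close> already are roots.\<close>
  let ?p = "Polynomial.monom 1 q + [:0, - 1:] :: 'a poly"
  have "degree ?p = q"
    using q_gt_1 by (subst degree_add_eq_left) (auto simp: degree_monom_eq)
  moreover from this have "?p \<noteq> 0"
    using q_gt_1 by auto
  then have "card {x. poly ?p x = 0} \<le> degree ?p"
    by (rule card_poly_roots_bound)
  moreover have "{x. poly ?p x = 0} = {x. x ^ q = x}"
    by (simp add: poly_monom)
  ultimately have "K = {x. x ^ q = x}"
    using sub card_K by (intro card_seteq) auto
  then show ?thesis by auto
qed

lemma power_q_power_n: "x ^ (q ^ n) = (x :: 'a)"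
  using power_card_eq_self[of UNIV x] card_UNIV by simp

text \<open>The characteristic divides \<open>q ^ n\<close>, so it is the prime below
  \<open>q\<close>, and additivity is the freshman's dream.\<close>

lemma frobenius_hom: "comm_ring_hom (\<lambda>x :: 'a. x ^ q)"
proof -
  have char: "prime CHAR('a)"
    by (intro prime_CHAR_semidom finite_imp_CHAR_pos) simp
  obtain p k where p: "prime p" "q = p ^ k"
    using primepow_q by (auto simp: primepow_def)
  have "CHAR('a) dvd q ^ n"
    using CHAR_dvd_CARD[where ?'a = 'a] card_UNIV by simp
  then have "CHAR('a) dvd p"
    using char p by (metis prime_dvd_power)
  then have "CHAR('a) = p"
    using char p by (metis primes_dvd_imp_eq)
  then have "(x + y) ^ q = x ^ q + y ^ q" for x y :: 'a
    using freshmans_dream'[OF char] p by blast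
  then show ?thesis
    using q_gt_1 by unfold_locales (auto simp: power_mult_distrib)
qed

lemma frobenius_Gal: "(\<lambda>x. x ^ q) \<in> carrier (Gal K)"
proof -
  interpret comm_ring_hom "\<lambda>x :: 'a. x ^ q" by (rule frobenius_hom)
  have "inj (\<lambda>x :: 'a. x ^ q)"
  proof (rule injI)
    fix x y :: 'a
    assume "x ^ q = y ^ q"
    then have "(x - y) ^ q = 0"
      by (simp add: hom_minus)
    then show "x = y" by simp
  qed
  moreover from this have "surj (\<lambda>x :: 'a. x ^ q)"
    by (intro finite_UNIV_inj_surj) simp_all
  ultimately show ?thesis
    by (simp add: Gal_iff frobenius_hom power_q_eq_iff bij_def)
qed

text \<open>The polynomial \<open>P\<close>, whose roots are the Frobenius iterates of
  \<open>x\<close>, is Frobenius-invariant and so has coefficients in \<open>K\<close>. Hence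
  \<sigma> fixes \<open>P\<close> and sends its root \<open>x\<close> to another root.\<close>

lemma Gal_eq_frobenius_power:
  assumes "\<sigma> \<in> carrier (Gal K)"
  obtains i where "\<sigma> x = x ^ (q ^ i)"
proof -
  interpret \<sigma>: comm_ring_hom \<sigma> using assms by (simp add: Gal_iff)
  interpret fr: comm_ring_hom "\<lambda>x :: 'a. x ^ q" by (rule frobenius_hom)
  interpret frp: map_poly_comm_ring_hom "\<lambda>x :: 'a. x ^ q" ..
  interpret \<sigma>p: map_poly_comm_ring_hom \<sigma> ..
  define P where "P = (\<Prod>i<n. [:- (x ^ (q ^ i)), 1:])"
  have "n > 0"
  proof (rule ccontr)
    assume "\<not> n > 0"
    then have "card (UNIV :: 'a set) = 1" using card_UNIV by simp
    then show False by (metis card_1_singletonE UNIV_I singletonD zero_neq_one)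
  qed
  have "map_poly (\<lambda>x. x ^ q) P = (\<Prod>i<n. [:- (x ^ (q ^ Suc i)), 1:])"
    by (simp add: P_def frp.hom_prod fr.map_poly_pCons_hom fr.hom_uminus mult.commute
        flip: power_mult)
  also have "\<dots> = P"
  proof -
    \<comment> \<open>The Frobenius map shifts the index of each factor; the product is unchanged
      because \<open>x ^ (q ^ n) = x\<close> makes the factors at \<open>n\<close> and at 0
      equal.\<close>
    define f where "f i = [:- (x ^ (q ^ i)), 1:]" for i
    have "f 0 * (\<Prod>i<n. f (Suc i)) = f n * (\<Prod>i<n. f i)"
      by (metis prod.lessThan_Suc prod.lessThan_Suc_shift mult.commute)
    moreover have "f n = f 0" and "f 0 \<noteq> 0"
      by (simp_all add: f_def power_q_power_n)
    ultimately have "(\<Prod>i<n. f (Suc i)) = (\<Prod>i<n. f i)"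
      by simp
    then show ?thesis
      unfolding P_def f_def .
  qed
  finally have "Polynomial.coeff P j \<in> K" for j
    by (metis fr.coeff_map_poly_hom power_q_eq_iff)
  then have "map_poly \<sigma> P = P"
    using assms by (intro poly_eqI) (simp add: Gal_iff)
  moreover have "poly P x = 0"
    using \<open>n > 0\<close> by (auto simp: P_def poly_prod intro!: bexI[of _ 0])
  ultimately have "poly P (\<sigma> x) = 0"
    by (metis \<sigma>.poly_map_poly \<sigma>.hom_zero)
  then show thesis
    using that by (auto simp: P_def poly_prod)
qed

text \<open>
  The exponent \<open>i\<close> above may depend on \<open>x\<close>. This suffices, because \<open>\<sigma>\<close> commutes with powers and
  hence acts as \<open>y \<mapsto> y ^ (q ^ i)\<close> on the whole orbit of \<open>x\<close>.
\<close>

lemma Gal_power_n: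
  assumes "\<sigma> \<in> carrier (Gal K)"
  shows "\<sigma> ^^ n = id"
proof
  fix x
  interpret comm_ring_hom \<sigma> using assms by (simp add: Gal_iff)
  obtain i where i: "\<sigma> x = x ^ (q ^ i)"
    using Gal_eq_frobenius_power[OF assms] .
  have "(\<sigma> ^^ k) x = x ^ ((q ^ i) ^ k)" for k
    by (induction k) (simp_all add: hom_power i mult.commute flip: power_mult)
  \<comment> \<open>Used with \<open>k = i\<close>: the exponent \<open>(q ^ i) ^ n\<close> of the
    \<open>n\<close>-th iterate equals \<open>(q ^ n) ^ i\<close>.\<close>
  moreover have "x ^ ((q ^ n) ^ k) = x" for k
    by (induction k) (simp_all add: power_q_power_n power_mult)
  ultimately show "(\<sigma> ^^ n) x = id x"
    by (metis id_apply mult.commute power_mult)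
qed

lemma fixed_by_generator:
  assumes "\<sigma> \<in> carrier (Gal K)" and "generate (Gal K) {\<sigma>} = carrier (Gal K)" and "\<sigma> x = x"
  shows "x \<in> K"
  using generate_Gal_fixes[OF assms(1,3)] frobenius_Gal assms(2) power_q_eq_iff by blast

end

theorem theorem4:
  fixes q n d :: nat
    and K :: "'a::{finite,field} set"
    and \<sigma> :: "'a \<Rightarrow> 'a"
    and L :: "'a poly"
  assumes "primepow q"
    and "n \<ge> 1"
    and "subfield K class_ring"
    and "card K = q"
    and "card (UNIV :: 'a set) = q ^ n"
    and "\<sigma> \<in> carrier (Gal K)"
    and "generate (Gal K) {\<sigma>} = carrier (Gal K)"
    and "d \<ge> 1"
    and "sigma_linearized q \<sigma> d L"
  shows "\<forall>i. Polynomial.coeff (char_poly (A_mat q n \<sigma> d L)) i \<in> K"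
proof
  fix i
  interpret finite_field_extension K q n
    using assms by (intro finite_field_extension.intro)
  interpret comm_ring_hom \<sigma>
    using assms(6) by (simp add: Gal_iff)
  have "C_mat q \<sigma> d L \<in> carrier_mat d d"
    by (simp add: C_mat_def)
  then have "map_poly \<sigma> (char_poly (A_mat q n \<sigma> d L)) = char_poly (A_mat q n \<sigma> d L)"
    unfolding A_mat_def
    by (intro char_poly_twisted_product comm_ring_hom_axioms assms(2) Gal_power_n assms(6))
  then show "Polynomial.coeff (char_poly (A_mat q n \<sigma> d L)) i \<in> K"
    by (metis coeff_map_poly_hom fixed_by_generator assms(6,7))
qed

end
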